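(* Let $h>0$, $a\in\mathbb{R}$, $b=a+mh$ with $m\in\{2,3,\ldots\}$, let $f:\{a,a+h,\ldots,b\}\to\mathbb{R}$ and let $\mu,\nu\ge 0$. Then $$\left({_{a+\nu h}}\Delta_h^{-\mu}\,{_a}\Delta_h^{-\nu}f\right)(t)=\left({_a}\Delta_h^{-(\mu+\nu)}f\right)(t)$$ for all $t\in\{a+(\mu+\nu)h,\,a+(\mu+\nu)h+h,\ldots,b+(\mu+\nu)h\}$; and $$\left({_h}\Delta_{b-\nu h}^{-\mu}\,{_h}\Delta_b^{-\nu}f\right)(t)=\left({_h}\Delta_b^{-(\mu+\nu)}f\right)(t)$$ for all $t\in\{b-(\mu+\nu)h,\,b-(\mu+\nu)h-h,\ldots,a-(\mu+\nu)h\}$.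
   Context: For $h>0$ and $x,y\in\mathbb{R}$ the $h$-factorial function is $x_h^{(y)} = h^y\,\dfrac{\Gamma(\frac{x}{h}+1)}{\Gamma(\frac{x}{h}+1-y)}$, where $\Gamma$ is the Euler gamma function, with the convention that division at a pole yields zero. Put $\sigma_h(t)=t+h$. For a grid $\{p,p+h,\ldots,q\}$ (with $p,q\in\mathbb{R}$, $q-p$ a nonnegative integer multiple of $h$) and a real-valued function $g$ on it, the left and right fractional $h$-sums of order $\nu>0$ are $$\left({_p}\Delta_h^{-\nu}g\right)(t)=\frac{1}{\Gamma(\nu)}\sum_{k=\frac{p}{h}}^{\frac{t}{h}-\nu}(t-\sigma_h(kh))_h^{(\nu-1)}g(kh)\,h,\quad t\in\{p+\nu h,p+\nu h+h,\ldots,q+\nu h\},$$ $$\left({_h}\Delta_q^{-\nu}g\right)(t)=\frac{1}{\Gamma(\nu)}\sum_{k=\frac{t}{h}+\nu}^{\frac{q}{h}}(kh-\sigma_h(t))_h^{(\nu-1)}g(kh)\,h,\quad t\in\{p-\nu h,p-\nu h+h,\ldots,q-\nu h\},$$ where $k$ runs in unit steps from the lower to the upper limit (limits not necessarily integers). For $\nu=0$ both operators are the identity: ${_p}\Delta_h^{0}g=g$ and ${_h}\Delta_q^{0}g=g$. *)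

theory Defs
  imports "HOL-Analysis.Analysis"
begin

text \<open>
  The points \<open>l, l + s, l + 2 s, \<dots>\<close> up to \<open>u\<close>, for a step \<open>s > 0\<close>. If \<open>u - l\<close> is a nonnegative
  integer multiple of \<open>s\<close>, this is the grid \<open>{l, l + s, \<dots>, u}\<close>. The end points need not be
  multiples of the step, so the summation indices below are real numbers.
\<close>
definition step_grid :: "real \<Rightarrow> real \<Rightarrow> real \<Rightarrow> real set" where
  "step_grid s l u = {l + real n * s | n. l + real n * s \<le> u}"

definition hsigma :: "real \<Rightarrow> real \<Rightarrow> real" where
  "hsigma h t = t + h"

text \<open>
  \<open>Gamma\<close> takes the value 0 at its poles and division by 0 gives 0, so the quotient is 0 when the
  denominator is at a pole, which is the usual convention for factorial functions.
\<close>
definition hfactorial :: "real \<Rightarrow> real \<Rightarrow> real \<Rightarrow> real" where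
  "hfactorial h x y = h powr y * (Gamma (x / h + 1) / Gamma (x / h + 1 - y))"

text \<open>
  The left sum with base point \<open>p\<close> and the right sum with base point \<open>q\<close>, of order \<open>\<nu> \<ge> 0\<close>.
  A function on a grid is represented by a total function, of which only the values on the grid
  matter: for \<open>t\<close> in \<open>step_grid h (p + \<nu> * h) (q + \<nu> * h)\<close> (left) or in
  \<open>step_grid h (p - \<nu> * h) (q - \<nu> * h)\<close> (right), \<open>g\<close> is evaluated only on \<open>step_grid h p q\<close>.
\<close>
definition left_hsum :: "real \<Rightarrow> real \<Rightarrow> real \<Rightarrow> (real \<Rightarrow> real) \<Rightarrow> real \<Rightarrow> real" where
  "left_hsum h p \<nu> g t =
    (if \<nu> = 0 then g t
     else 1 / Gamma \<nu> *
       (\<Sum>k\<in>step_grid 1 (p / h) (t / h - \<nu>). hfactorial h (t - hsigma h (k * h)) (\<nu> - 1) * g (k * h) * h))"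

definition right_hsum :: "real \<Rightarrow> real \<Rightarrow> real \<Rightarrow> (real \<Rightarrow> real) \<Rightarrow> real \<Rightarrow> real" where
  "right_hsum h q \<nu> g t =
    (if \<nu> = 0 then g t
     else 1 / Gamma \<nu> *
       (\<Sum>k\<in>step_grid 1 (t / h + \<nu>) (q / h). hfactorial h (k * h - hsigma h t) (\<nu> - 1) * g (k * h) * h))"

end

theory Submission
  imports Defs
begin

text \<open>
  At the \<open>n\<close>-th point of its grid, a fractional sum of order \<open>\<nu>\<close> is \<open>h powr \<nu>\<close> times the \<open>n\<close>-th
  coefficient of the Cauchy product of the values of the function with the binomial series of
  \<open>(1 - X)\<close> to the power \<open>-\<nu>\<close>. The composition rule is therefore associativity of the product
  together with the addition of exponents in the binomial series, which is Vandermonde's identity.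
\<close>

text \<open>With rising factorials the coefficients of the binomial series carry no signs, and \<nu>
  = 0 is covered too.\<close>

definition hsum_kernel :: "real \<Rightarrow> real fps" where
  "hsum_kernel \<nu> = Abs_fps (\<lambda>n. pochhammer \<nu> n / fact n)"

lemma hsum_kernel_0: "hsum_kernel 0 = 1"
  by (rule fps_ext) (auto simp: hsum_kernel_def pochhammer_0_left)

text \<open>Vandermonde for rising factorials is a binomial convolution; dividing by
  \<open>fact n\<close> turns it into a Cauchy product.\<close>

lemma hsum_kernel_add: "hsum_kernel (\<mu> + \<nu>) = hsum_kernel \<mu> * hsum_kernel \<nu>"
proof (rule fps_ext)
  fix n
  have "pochhammer (\<mu> + \<nu>) n / fact n =
      (\<Sum>k\<le>n. of_nat (n choose k) * pochhammer \<mu> k * pochhammer \<nu> (n - k) / fact n)"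
    by (simp add: pochhammer_binomial_sum sum_divide_distrib)
  also have "\<dots> = (\<Sum>k\<le>n. (pochhammer \<mu> k / fact k) * (pochhammer \<nu> (n - k) / fact (n - k)))"
    by (rule sum.cong) (auto simp: binomial_fact)
  finally show "fps_nth (hsum_kernel (\<mu> + \<nu>)) n = fps_nth (hsum_kernel \<mu> * hsum_kernel \<nu>) n"
    by (simp add: hsum_kernel_def fps_mult_nth atMost_atLeast0)
qed

text \<open>At this argument the Gamma quotient is \<open>Gamma (\<nu> + i) / Gamma (1 + i)\<close>.
  Its denominator is \<open>fact i\<close>, never a pole, and dividing by \<open>Gamma \<nu>\<close>
  leaves the rising factorial. The extra factor \<open>h\<close> raises the power from \<nu> - 1 to
  \<nu>.\<close>

lemma hfactorial_kernel:
  assumes "h > 0" "\<nu> > 0"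
  shows "1 / Gamma \<nu> * hfactorial h ((\<nu> + real i - 1) * h) (\<nu> - 1) * h =
    h powr \<nu> * fps_nth (hsum_kernel \<nu>) i"
proof -
  have "\<nu> \<notin> \<int>\<^sub>\<le>\<^sub>0" using assms by auto
  then have "pochhammer \<nu> i = Gamma (\<nu> + real i) / Gamma \<nu>"
    by (rule pochhammer_Gamma)
  moreover have "Gamma (1 + real i) = fact i"
    by (simp add: Gamma_fact)
  moreover have "h powr \<nu> = h powr (\<nu> - 1) * h"
    using assms by (simp add: powr_diff)
  moreover have "hfactorial h ((\<nu> + real i - 1) * h) (\<nu> - 1) =
      h powr (\<nu> - 1) * (Gamma (\<nu> + real i) / Gamma (1 + real i))"
    using assms by (simp add: hfactorial_def add.commute)
  ultimately show ?thesis
    by (simp add: hsum_kernel_def)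
qed

lemma step_grid_eq_image:
  assumes "s > 0" "u = l + real N * s"
  shows "step_grid s l u = (\<lambda>j. l + real j * s) ` {0..N}"
  using assms by (auto simp: step_grid_def)

lemma sum_step_grid:
  "(\<Sum>k\<in>step_grid 1 l (l + real N). F k) = (\<Sum>j=0..N. F (l + real j))"
  by (subst step_grid_eq_image[of 1 _ l N]) (auto simp: sum.reindex inj_on_def)

text \<open>The weight of the \<open>j\<close>-th sample depends only on \<open>N - j\<close>, so
  the sum is a convolution. For \<nu> = 0 the kernel is 1 and \<open>h powr 0 = 1\<close>, which
  matches the identity branch.\<close>

lemma left_hsum_eq_fps:
  assumes "h > 0" "\<nu> \<ge> 0"
  shows "left_hsum h p \<nu> g (p + \<nu> * h + real N * h) =
    h powr \<nu> * fps_nth (hsum_kernel \<nu> * Abs_fps (\<lambda>j. g (p + real j * h))) N"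
proof (cases "\<nu> = 0")
  case True
  with assms show ?thesis by (simp add: left_hsum_def hsum_kernel_0)
next
  case False
  let ?t = "p + \<nu> * h + real N * h"
  have t: "?t / h - \<nu> = p / h + real N"
    using assms by (simp add: field_simps)
  have "left_hsum h p \<nu> g ?t = (\<Sum>j=0..N. 1 / Gamma \<nu> *
      hfactorial h (?t - hsigma h ((p / h + real j) * h)) (\<nu> - 1) * h * g ((p / h + real j) * h))"
    unfolding left_hsum_def t sum_step_grid using False by (simp add: sum_distrib_left mult_ac)
  also have "\<dots> = (\<Sum>j=0..N. h powr \<nu> * fps_nth (hsum_kernel \<nu>) (N - j) * g (p + real j * h))"
  proof (rule sum.cong)
    fix j assume "j \<in> {0..N}"
    \<comment> \<open>The shift in \<open>hsigma\<close> accounts for the \<open>- 1\<close>; the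
      subtraction \<open>N - j\<close> is exact since \<open>j\<close> is at most
      \<open>N\<close>.\<close>
    then have "?t - hsigma h ((p / h + real j) * h) = (\<nu> + real (N - j) - 1) * h"
      using assms by (simp add: hsigma_def of_nat_diff field_simps)
    moreover have "(p / h + real j) * h = p + real j * h"
      using assms by (simp add: field_simps)
    ultimately show "1 / Gamma \<nu> * hfactorial h (?t - hsigma h ((p / h + real j) * h)) (\<nu> - 1) * h
        * g ((p / h + real j) * h) = h powr \<nu> * fps_nth (hsum_kernel \<nu>) (N - j) * g (p + real j * h)"
      using hfactorial_kernel[of h \<nu> "N - j"] assms False by simp
  qed simp
  also have "\<dots> = h powr \<nu> * fps_nth (hsum_kernel \<nu> * Abs_fps (\<lambda>j. g (p + real j * h))) N"
    \<comment> \<open>The factors are swapped because the summation index \<open>j\<close> belongs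
      to the samples and \<open>N - j\<close> to the kernel.\<close>
    unfolding mult.commute[of "hsum_kernel \<nu>"] fps_mult_nth by (simp add: sum_distrib_left mult_ac)
  finally show ?thesis .
qed

text \<open>Counting the samples downwards from \<open>q\<close> gives the same convolution as on
  the left.\<close>

lemma right_hsum_eq_fps:
  assumes "h > 0" "\<nu> \<ge> 0"
  shows "right_hsum h q \<nu> g (q - \<nu> * h - real N * h) =
    h powr \<nu> * fps_nth (hsum_kernel \<nu> * Abs_fps (\<lambda>j. g (q - real j * h))) N"
proof (cases "\<nu> = 0")
  case True
  with assms show ?thesis by (simp add: right_hsum_def hsum_kernel_0)
next
  case False
  let ?t = "q - \<nu> * h - real N * h"
  \<comment> \<open>The lower summation limit. Counted upwards from it, \<open>i\<close> is the
    kernel index itself, and the sample lies \<open>N - i\<close> steps below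
    \<open>q\<close>.\<close>
  define l where "l = q / h - real N"
  have l: "?t / h + \<nu> = l" "q / h = l + real N"
    using assms by (simp_all add: l_def field_simps)
  have "right_hsum h q \<nu> g ?t = (\<Sum>i=0..N. 1 / Gamma \<nu> *
      hfactorial h ((l + real i) * h - hsigma h ?t) (\<nu> - 1) * h * g ((l + real i) * h))"
    unfolding right_hsum_def l sum_step_grid using False by (simp add: sum_distrib_left mult_ac)
  also have "\<dots> = (\<Sum>i=0..N. h powr \<nu> * fps_nth (hsum_kernel \<nu>) i * g (q - real (N - i) * h))"
  proof (rule sum.cong)
    fix i assume i: "i \<in> {0..N}"
    then have "(l + real i) * h - hsigma h ?t = (\<nu> + real i - 1) * h"
      using assms by (simp add: l_def hsigma_def field_simps)
    moreover have "(l + real i) * h = q - real (N - i) * h"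
      using assms i by (simp add: l_def of_nat_diff field_simps)
    ultimately show "1 / Gamma \<nu> * hfactorial h ((l + real i) * h - hsigma h ?t) (\<nu> - 1) * h
        * g ((l + real i) * h) = h powr \<nu> * fps_nth (hsum_kernel \<nu>) i * g (q - real (N - i) * h)"
      using hfactorial_kernel[of h \<nu> i] assms False by simp
  qed simp
  also have "\<dots> = h powr \<nu> * fps_nth (hsum_kernel \<nu> * Abs_fps (\<lambda>j. g (q - real j * h))) N"
    by (simp add: fps_mult_nth sum_distrib_left mult_ac)
  finally show ?thesis .
qed

text \<open>The algebraic core shared by both sides: \<open>F\<close> holds the values of the
  original function and \<open>G\<close> those of the inner sum. The scalar
  \<open>h powr \<nu>\<close> moves out as a constant series, so both kernels and powers of
  \<open>h\<close> combine.\<close>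

lemma hsum_kernel_compose:
  assumes "\<And>j. G j = h powr \<nu> * fps_nth (hsum_kernel \<nu> * F) j"
  shows "h powr \<mu> * fps_nth (hsum_kernel \<mu> * Abs_fps G) N =
    h powr (\<mu> + \<nu>) * fps_nth (hsum_kernel (\<mu> + \<nu>) * F) N"
proof -
  have "Abs_fps G = fps_const (h powr \<nu>) * (hsum_kernel \<nu> * F)"
    by (rule fps_ext) (simp add: assms)
  then have "hsum_kernel \<mu> * Abs_fps G = fps_const (h powr \<nu>) * (hsum_kernel (\<mu> + \<nu>) * F)"
    by (simp add: hsum_kernel_add mult_ac)
  then show ?thesis by (simp add: powr_add)
qed

lemma left_hsum_compose:
  assumes "h > 0" "\<mu> \<ge> 0" "\<nu> \<ge> 0"
  shows "left_hsum h (a + \<nu> * h) \<mu> (left_hsum h a \<nu> f) (a + (\<mu> + \<nu>) * h + real N * h) =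
    left_hsum h a (\<mu> + \<nu>) f (a + (\<mu> + \<nu>) * h + real N * h)"
proof -
  \<comment> \<open>The point is rewritten relative to the base \<open>a + \<nu> * h\<close> of the
    outer sum.\<close>
  have "a + (\<mu> + \<nu>) * h + real N * h = a + \<nu> * h + \<mu> * h + real N * h"
    by (simp add: algebra_simps)
  then have "left_hsum h (a + \<nu> * h) \<mu> (left_hsum h a \<nu> f) (a + (\<mu> + \<nu>) * h + real N * h) =
      h powr \<mu> * fps_nth (hsum_kernel \<mu> * Abs_fps (\<lambda>j. left_hsum h a \<nu> f (a + \<nu> * h + real j * h))) N"
    using assms by (simp only: left_hsum_eq_fps)
  also have "\<dots> = h powr (\<mu> + \<nu>) * fps_nth (hsum_kernel (\<mu> + \<nu>) * Abs_fps (\<lambda>j. f (a + real j * h))) N"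
    by (rule hsum_kernel_compose) (use assms in \<open>simp only: left_hsum_eq_fps\<close>)
  also have "\<dots> = left_hsum h a (\<mu> + \<nu>) f (a + (\<mu> + \<nu>) * h + real N * h)"
    by (rule left_hsum_eq_fps[symmetric]) (use assms in auto)
  finally show ?thesis .
qed

lemma right_hsum_compose:
  assumes "h > 0" "\<mu> \<ge> 0" "\<nu> \<ge> 0"
  shows "right_hsum h (b - \<nu> * h) \<mu> (right_hsum h b \<nu> f) (b - (\<mu> + \<nu>) * h - real N * h) =
    right_hsum h b (\<mu> + \<nu>) f (b - (\<mu> + \<nu>) * h - real N * h)"
proof -
  have "b - (\<mu> + \<nu>) * h - real N * h = b - \<nu> * h - \<mu> * h - real N * h"
    by (simp add: algebra_simps)
  then have "right_hsum h (b - \<nu> * h) \<mu> (right_hsum h b \<nu> f) (b - (\<mu> + \<nu>) * h - real N * h) =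
      h powr \<mu> * fps_nth (hsum_kernel \<mu> * Abs_fps (\<lambda>j. right_hsum h b \<nu> f (b - \<nu> * h - real j * h))) N"
    using assms by (simp only: right_hsum_eq_fps)
  also have "\<dots> = h powr (\<mu> + \<nu>) * fps_nth (hsum_kernel (\<mu> + \<nu>) * Abs_fps (\<lambda>j. f (b - real j * h))) N"
    by (rule hsum_kernel_compose) (use assms in \<open>simp only: right_hsum_eq_fps\<close>)
  also have "\<dots> = right_hsum h b (\<mu> + \<nu>) f (b - (\<mu> + \<nu>) * h - real N * h)"
    by (rule right_hsum_eq_fps[symmetric]) (use assms in auto)
  finally show ?thesis .
qed

theorem theorem12:
  fixes h a b \<mu> \<nu> :: real and m :: nat and f :: "real \<Rightarrow> real"
  assumes "h > 0" and "m \<ge> 2" and "b = a + real m * h" and "\<mu> \<ge> 0" and "\<nu> \<ge> 0"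
  shows "(\<forall>t\<in>step_grid h (a + (\<mu> + \<nu>) * h) (b + (\<mu> + \<nu>) * h).
            left_hsum h (a + \<nu> * h) \<mu> (left_hsum h a \<nu> f) t = left_hsum h a (\<mu> + \<nu>) f t) \<and>
         (\<forall>t\<in>step_grid h (a - (\<mu> + \<nu>) * h) (b - (\<mu> + \<nu>) * h).
            right_hsum h (b - \<nu> * h) \<mu> (right_hsum h b \<nu> f) t = right_hsum h b (\<mu> + \<nu>) f t)"
proof (intro conjI ballI)
  fix t assume "t \<in> step_grid h (a + (\<mu> + \<nu>) * h) (b + (\<mu> + \<nu>) * h)"
  then obtain N where t: "t = a + (\<mu> + \<nu>) * h + real N * h"
    by (auto simp: step_grid_def)
  show "left_hsum h (a + \<nu> * h) \<mu> (left_hsum h a \<nu> f) t = left_hsum h a (\<mu> + \<nu>) f t"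
    unfolding t by (rule left_hsum_compose) (use assms in auto)
next
  fix t assume "t \<in> step_grid h (a - (\<mu> + \<nu>) * h) (b - (\<mu> + \<nu>) * h)"
  \<comment> \<open>The grid is enumerated upwards from its lower end, whereas
    \<open>right_hsum_compose\<close> counts down from the upper end; hence the index
    \<open>n\<close> is reversed to \<open>m - n\<close>.\<close>
  moreover have "b - (\<mu> + \<nu>) * h = a - (\<mu> + \<nu>) * h + real m * h"
    using assms by simp
  ultimately obtain n where "n \<le> m" "t = a - (\<mu> + \<nu>) * h + real n * h"
    using step_grid_eq_image[OF \<open>h > 0\<close>] by auto
  then have t: "t = b - (\<mu> + \<nu>) * h - real (m - n) * h"
    using assms by (simp add: of_nat_diff algebra_simps)
  show "right_hsum h (b - \<nu> * h) \<mu> (right_hsum h b \<nu> f) t = right_hsum h b (\<mu> + \<nu>) f t"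
    unfolding t by (rule right_hsum_compose) (use assms in auto)
qed

end
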